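(* Let $\mathcal K\subseteq\mathbb R^{\tilde n}$ and let $\mathcal L=(\mathcal K,\mathbb N_N,\{l_n\}_{n\in\mathbb N_N})$ be a PCF self-similar structure equipped with a regular harmonic structure $(H,\{r_i\}_{i\in\mathbb N_N})$. Suppose there exists $\mathbf b=\{b_i\}_{i\in\mathbb N_N}$ with $0<b_i<1$ for each $i$ such that at least one of the following holds: (1) there exists a constant $k_1>0$ such that for every $0<\lambda<1$ and all $w,\tau\in\Lambda_{\mathbf b}(\lambda)$ with $\mathcal K_w\cap\mathcal K_\tau=\emptyset$ one has $\mathrm{dist}(\mathcal K_w,\mathcal K_\tau)\ge k_1\lambda$; (2) there exist constants $k_2>0$ and $M'>0$ such that for every $0<\lambda<1$ and every $x_0\in\mathcal K$, each point $y\in B(x_0,k_2\lambda)$ of $\mathcal K$ can be connected to $x_0$ by a sequence of points $\{x_k\}_{k=0}^{n_0}$ in $\mathcal K$ with $1\le n_0\le M'$, $x_{n_0}=y$, and such that for each $1\le k\le n_0$ there is $w\in\Lambda_{\mathbf b}(\lambda)$ with $x_{k-1},x_k\in\mathcal K_w$. Let $V_0=\{p_1,\dots,p_L\}$, let $\mathcal J\subset\mathbb R$ be compact, and let $u:V_1\to\mathbb R$ have values in $\mathcal J$. For each $n\in\mathbb N_N$ let $h_n:\mathcal K\to\mathbb R$ be a nonconstant harmonic function and $s_n:\mathcal J\to\mathcal J$ an Edelstein contraction such that $F_n(x,y)=h_n(x)+s_n(y)$ defines a (continuous) map $F_n:\mathcal K\times\mathcal J\to\mathcal J$ with $h_n(p_k)+s_n(u(p_k))=u(l_n(p_k))$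 for all $n\in\mathbb N_N$ and $1\le k\le L$. Let $W_n:\mathcal K\times\mathcal J\to\mathcal K\times\mathcal J$, $W_n(x,y)=(l_n(x),F_n(x,y))$. Then there exists a metric $d_\theta$ on $\mathcal K\times\mathcal J\subset\mathbb R^{\tilde n+1}$, topologically equivalent to the Euclidean metric, with respect to which every $W_n$, $n\in\mathbb N_N$, is an Edelstein contraction.
   Context: $\mathbb N_N=\{1,\dots,N\}$. Self-similar structure: $\mathcal K$ is a compact metrizable space (here a compact subset of $\mathbb R^{\tilde n}$), each $l_i:\mathcal K\to\mathcal K$ is a continuous injection, and there is a continuous surjection $\pi:\Sigma\to\mathcal K$, $\Sigma=\mathbb N_N^{\mathbb N}$, with $l_i\circ\pi=\pi\circ\sigma_i$, where $\sigma_i(w_1w_2\ldots)=iw_1w_2\ldots$. Let $\sigma(w_1w_2w_3\ldots)=w_2w_3\ldots$. The critical set is $\mathcal C=\pi^{-1}\big(\bigcup_{i\ne j}(l_i(\mathcal K)\cap l_j(\mathcal K))\big)$, the post-critical set is $\mathcal P=\bigcup_{n\ge1}\sigma^n(\mathcal C)$, and $V_0=\pi(\mathcal P)$. The structure is post-critically finite (PCF) if $\mathcal P$ is finite. For a word $w=w_1\cdots w_m\in\mathbb N_N^m$, $l_w=l_{w_1}\circ\cdots\circ l_{w_m}$, $\mathcal K_w=l_w(\mathcal K)$; $V_m=\bigcup_{w\in\mathbb N_N^m}l_w(V_0)$. Harmonic structure: a Laplace matrix on $V_0$ is a symmetric matrix $H$ with $H_{pq}\ge0$ for $p\ne q$,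 $(f,Hf):=\sum_{p}f(p)\sum_qH_{pq}f(q)\le0$ for all $f:V_0\to\mathbb R$, and $Hf=0$ iff $f$ is constant. Given $H$ and positive numbers $\mathbf r=\{r_i\}_{i\in\mathbb N_N}$, put $r_w=r_{w_1}\cdots r_{w_m}$, $\mathcal E_0(f)=-(f,Hf)$ and $\mathcal E_m(f)=\sum_{w\in\mathbb N_N^m}r_w^{-1}\mathcal E_0(f\circ l_w|_{V_0})$. $(H,\mathbf r)$ is a harmonic structure if $\min\{\mathcal E_1(g):g:V_1\to\mathbb R,\ g|_{V_0}=f\}=\mathcal E_0(f)$ for all $f:V_0\to\mathbb R$; it is regular if $r_i<1$ for all $i$. A harmonic function with boundary values $f:V_0\to\mathbb R$ is the continuous function $h:\mathcal K\to\mathbb R$ with $h|_{V_0}=f$ such that, for each $m\ge1$, $h|_{V_m}$ minimizes $\mathcal E_m$ among functions on $V_m$ that equal $f$ on $V_0$. Partition: for $0<\lambda<1$, $\Lambda_{\mathbf b}(\lambda)=\{w=i_1i_2\cdots i_m\in\bigcup_{m\ge1}\mathbb N_N^m:\ b_w\le\lambda<b_{i_1\cdots i_{m-1}}\}$, where $b_w=b_{i_1}\cdots b_{i_m}$ (and $b$ of the empty word is $1$). $\mathrm{dist}$ and the balls $B(x_0,\rho)$ are with respect to the Euclidean metric. An Edelstein contraction on a metric space $(X,d)$ is a map $g:X\to X$ with $d(g(x),g(y))<d(x,y)$ whenever $x\ne y$; on $\mathcal J$ the metric is $|\cdot|$. *)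

theory Defs
  imports "HOL-Analysis.Analysis"
begin

text \<open>
  The alphabet is the set \<open>{1..N}\<close> of natural numbers. Infinite words are functions
  \<open>nat \<Rightarrow> nat\<close> with positions counted from 0, finite words are lists.
\<close>

definition shift_space :: "nat \<Rightarrow> (nat \<Rightarrow> nat) topology" where
  "shift_space N = product_topology (\<lambda>_. discrete_topology {1..N}) UNIV"

definition left_shift :: "(nat \<Rightarrow> nat) \<Rightarrow> (nat \<Rightarrow> nat)" where
  "left_shift w = (\<lambda>k. w (Suc k))"

definition words :: "nat \<Rightarrow> nat \<Rightarrow> nat list set" where
  "words N m = {w. set w \<subseteq> {1..N} \<and> length w = m}"

definition word_map :: "(nat \<Rightarrow> 'a \<Rightarrow> 'a) \<Rightarrow> nat list \<Rightarrow> 'a \<Rightarrow> 'a" where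
  "word_map l w = foldr (\<lambda>i g. l i \<circ> g) w id"

definition word_weight :: "(nat \<Rightarrow> real) \<Rightarrow> nat list \<Rightarrow> real" where
  "word_weight b w = (\<Prod>i\<leftarrow>w. b i)"

definition cell :: "'a set \<Rightarrow> (nat \<Rightarrow> 'a \<Rightarrow> 'a) \<Rightarrow> nat list \<Rightarrow> 'a set" where
  "cell K l w = word_map l w ` K"

text \<open>Prepending a letter \<open>i\<close> to an infinite word \<open>w\<close> is \<open>case_nat i w\<close>.\<close>

definition self_similar_structure ::
  "'a::topological_space set \<Rightarrow> nat \<Rightarrow> (nat \<Rightarrow> 'a \<Rightarrow> 'a) \<Rightarrow> ((nat \<Rightarrow> nat) \<Rightarrow> 'a) \<Rightarrow> bool" where
  "self_similar_structure K N l \<pi> \<longleftrightarrow>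
     compact K \<and>
     (\<forall>i\<in>{1..N}. l i ` K \<subseteq> K \<and> continuous_on K (l i) \<and> inj_on (l i) K) \<and>
     continuous_map (shift_space N) (top_of_set K) \<pi> \<and>
     \<pi> ` topspace (shift_space N) = K \<and>
     (\<forall>i\<in>{1..N}. \<forall>w\<in>topspace (shift_space N). l i (\<pi> w) = \<pi> (case_nat i w))"

definition critical_set ::
  "'a set \<Rightarrow> nat \<Rightarrow> (nat \<Rightarrow> 'a \<Rightarrow> 'a) \<Rightarrow> ((nat \<Rightarrow> nat) \<Rightarrow> 'a) \<Rightarrow> (nat \<Rightarrow> nat) set" where
  "critical_set K N l \<pi> =
     {w \<in> topspace (shift_space N). \<exists>i\<in>{1..N}. \<exists>j\<in>{1..N}. i \<noteq> j \<and> \<pi> w \<in> l i ` K \<inter> l j ` K}"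

definition post_critical_set ::
  "'a set \<Rightarrow> nat \<Rightarrow> (nat \<Rightarrow> 'a \<Rightarrow> 'a) \<Rightarrow> ((nat \<Rightarrow> nat) \<Rightarrow> 'a) \<Rightarrow> (nat \<Rightarrow> nat) set" where
  "post_critical_set K N l \<pi> = (\<Union>n\<in>{1..}. (left_shift ^^ n) ` critical_set K N l \<pi>)"

definition pcf_structure ::
  "'a::topological_space set \<Rightarrow> nat \<Rightarrow> (nat \<Rightarrow> 'a \<Rightarrow> 'a) \<Rightarrow> ((nat \<Rightarrow> nat) \<Rightarrow> 'a) \<Rightarrow> bool" where
  "pcf_structure K N l \<pi> \<longleftrightarrow>
     self_similar_structure K N l \<pi> \<and> finite (post_critical_set K N l \<pi>)"

definition boundary0 ::
  "'a set \<Rightarrow> nat \<Rightarrow> (nat \<Rightarrow> 'a \<Rightarrow> 'a) \<Rightarrow> ((nat \<Rightarrow> nat) \<Rightarrow> 'a) \<Rightarrow> 'a set" where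
  "boundary0 K N l \<pi> = \<pi> ` post_critical_set K N l \<pi>"

definition vertices ::
  "nat \<Rightarrow> (nat \<Rightarrow> 'a \<Rightarrow> 'a) \<Rightarrow> 'a set \<Rightarrow> nat \<Rightarrow> 'a set" where
  "vertices N l V\<^sub>0 m = (\<Union>w\<in>words N m. word_map l w ` V\<^sub>0)"

text \<open>
  Matrices on \<open>V\<^sub>0\<close> and functions on the vertex sets are total functions; only their values
  on \<open>V\<^sub>0\<close> and \<open>vertices N l V\<^sub>0 m\<close>, respectively, enter below.
\<close>

definition quad_form :: "'a set \<Rightarrow> ('a \<Rightarrow> 'a \<Rightarrow> real) \<Rightarrow> ('a \<Rightarrow> real) \<Rightarrow> real" where
  "quad_form V\<^sub>0 H f = (\<Sum>p\<in>V\<^sub>0. f p * (\<Sum>q\<in>V\<^sub>0. H p q * f q))"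

definition laplace_matrix :: "'a set \<Rightarrow> ('a \<Rightarrow> 'a \<Rightarrow> real) \<Rightarrow> bool" where
  "laplace_matrix V\<^sub>0 H \<longleftrightarrow>
     (\<forall>p\<in>V\<^sub>0. \<forall>q\<in>V\<^sub>0. H p q = H q p) \<and>
     (\<forall>p\<in>V\<^sub>0. \<forall>q\<in>V\<^sub>0. p \<noteq> q \<longrightarrow> 0 \<le> H p q) \<and>
     (\<forall>f. quad_form V\<^sub>0 H f \<le> 0) \<and>
     (\<forall>f. (\<forall>p\<in>V\<^sub>0. (\<Sum>q\<in>V\<^sub>0. H p q * f q) = 0) \<longleftrightarrow> f constant_on V\<^sub>0)"

definition energy ::
  "nat \<Rightarrow> (nat \<Rightarrow> 'a \<Rightarrow> 'a) \<Rightarrow> 'a set \<Rightarrow> ('a \<Rightarrow> 'a \<Rightarrow> real) \<Rightarrow> (nat \<Rightarrow> real) \<Rightarrow> nat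
     \<Rightarrow> ('a \<Rightarrow> real) \<Rightarrow> real" where
  "energy N l V\<^sub>0 H r m f =
     (\<Sum>w\<in>words N m. inverse (word_weight r w) * (- quad_form V\<^sub>0 H (f \<circ> word_map l w)))"

definition harmonic_structure ::
  "nat \<Rightarrow> (nat \<Rightarrow> 'a \<Rightarrow> 'a) \<Rightarrow> 'a set \<Rightarrow> ('a \<Rightarrow> 'a \<Rightarrow> real) \<Rightarrow> (nat \<Rightarrow> real) \<Rightarrow> bool" where
  "harmonic_structure N l V\<^sub>0 H r \<longleftrightarrow>
     laplace_matrix V\<^sub>0 H \<and>
     (\<forall>i\<in>{1..N}. 0 < r i) \<and>
     (\<forall>f. (\<exists>g. (\<forall>p\<in>V\<^sub>0. g p = f p) \<and> energy N l V\<^sub>0 H r 1 g = - quad_form V\<^sub>0 H f) \<and>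
          (\<forall>g. (\<forall>p\<in>V\<^sub>0. g p = f p) \<longrightarrow> - quad_form V\<^sub>0 H f \<le> energy N l V\<^sub>0 H r 1 g))"

definition regular_harmonic_structure ::
  "nat \<Rightarrow> (nat \<Rightarrow> 'a \<Rightarrow> 'a) \<Rightarrow> 'a set \<Rightarrow> ('a \<Rightarrow> 'a \<Rightarrow> real) \<Rightarrow> (nat \<Rightarrow> real) \<Rightarrow> bool" where
  "regular_harmonic_structure N l V\<^sub>0 H r \<longleftrightarrow>
     harmonic_structure N l V\<^sub>0 H r \<and> (\<forall>i\<in>{1..N}. r i < 1)"

definition harmonic_with_boundary_values ::
  "'a::topological_space set \<Rightarrow> nat \<Rightarrow> (nat \<Rightarrow> 'a \<Rightarrow> 'a) \<Rightarrow> 'a set \<Rightarrow> ('a \<Rightarrow> 'a \<Rightarrow> real)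
     \<Rightarrow> (nat \<Rightarrow> real) \<Rightarrow> ('a \<Rightarrow> real) \<Rightarrow> ('a \<Rightarrow> real) \<Rightarrow> bool" where
  "harmonic_with_boundary_values K N l V\<^sub>0 H r f h \<longleftrightarrow>
     continuous_on K h \<and>
     (\<forall>p\<in>V\<^sub>0. h p = f p) \<and>
     (\<forall>m\<ge>1. \<forall>g. (\<forall>p\<in>V\<^sub>0. g p = f p) \<longrightarrow> energy N l V\<^sub>0 H r m h \<le> energy N l V\<^sub>0 H r m g)"

definition harmonic_function ::
  "'a::topological_space set \<Rightarrow> nat \<Rightarrow> (nat \<Rightarrow> 'a \<Rightarrow> 'a) \<Rightarrow> 'a set \<Rightarrow> ('a \<Rightarrow> 'a \<Rightarrow> real)
     \<Rightarrow> (nat \<Rightarrow> real) \<Rightarrow> ('a \<Rightarrow> real) \<Rightarrow> bool" where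
  "harmonic_function K N l V\<^sub>0 H r h \<longleftrightarrow>
     (\<exists>f. harmonic_with_boundary_values K N l V\<^sub>0 H r f h)"

definition word_partition :: "nat \<Rightarrow> (nat \<Rightarrow> real) \<Rightarrow> real \<Rightarrow> nat list set" where
  "word_partition N b t =
     {w. w \<noteq> [] \<and> set w \<subseteq> {1..N} \<and> word_weight b w \<le> t \<and> t < word_weight b (butlast w)}"

definition Edelstein_contraction :: "'a set \<Rightarrow> ('a \<Rightarrow> 'a \<Rightarrow> real) \<Rightarrow> ('a \<Rightarrow> 'a) \<Rightarrow> bool" where
  "Edelstein_contraction X d g \<longleftrightarrow>
     g ` X \<subseteq> X \<and> (\<forall>x\<in>X. \<forall>y\<in>X. x \<noteq> y \<longrightarrow> d (g x) (g y) < d x y)"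

end

theory Submission imports Defs begin

text \<open>
  By compactness of the shift space the cells \<open>l\<^sub>w(K)\<close> shrink uniformly as the word \<open>w\<close> gets
  longer, hence so do the oscillations of the continuous functions \<open>h n\<close> on them. If \<open>D m\<close> bounds the vertical extent of \<open>W\<^sub>w(K \<times> J)\<close> for words of length \<open>m\<close>,
  then \<open>D (m + 1)\<close> is at most \<open>D m\<close> plus a vanishing oscillation, minus a definite amount as long
  as \<open>D m\<close> stays away from 0, because an Edelstein contraction of a compact set decreases large
  distances by a definite amount. So the sets \<open>W\<^sub>w(K \<times> J)\<close> shrink uniformly as well. The metric is
  then \<open>d x y = (SUP w. c\<^sub>m dist (W\<^sub>w x) (W\<^sub>w y))\<close>, where \<open>m\<close> is the length of \<open>w\<close> and
  \<open>c\<^sub>m = (m + 1) / (m + 2)\<close> is strictly increasing: passing from \<open>(x, y)\<close> to \<open>(W n x, W n y)\<close>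
  replaces each weight by a strictly smaller one, and only finitely many words are relevant
  for the supremum.
\<close>

section \<open>Maps along finite words\<close>

lemma word_map_Nil [simp]: "word_map f [] = id"
  by (simp add: word_map_def)

lemma word_map_Cons [simp]: "word_map f (i # w) = f i \<circ> word_map f w"
  by (simp add: word_map_def)

text \<open>The last letter of a word acts first. Hence applying \<open>f i\<close> before
  \<open>word_map f w\<close> is the action of a longer word, which carries a larger weight; the
  contraction estimate rests on this.\<close>

lemma word_map_snoc: "word_map f (w @ [i]) = word_map f w \<circ> f i"
  by (induction w) (simp_all add: comp_assoc)

lemma word_map_in:
  assumes "\<And>i. i \<in> I \<Longrightarrow> f i ` X \<subseteq> X" and "w \<in> lists I" and "x \<in> X"
  shows "word_map f w x \<in> X"
  using assms(2) by induction (use assms in auto)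

lemma continuous_on_word_map:
  assumes "\<And>i. i \<in> I \<Longrightarrow> f i ` X \<subseteq> X" and "\<And>i. i \<in> I \<Longrightarrow> continuous_on X (f i)"
    and "w \<in> lists I"
  shows "continuous_on X (word_map f w)"
  using assms(3)
proof induction
  case Nil
  show ?case by (simp add: continuous_on_id)
next
  case (Cons i w)
  have "word_map f w ` X \<subseteq> X"
    using word_map_in[OF assms(1) Cons(2)] by auto
  then show ?case
    using Cons assms(2) unfolding word_map_Cons
    by (intro continuous_on_compose) (auto intro: continuous_on_subset)
qed

section \<open>Uniform shrinking along words and the weighted orbit metric\<close>

text \<open>The threshold \<open>M\<close> is uniform over all words and all pairs of points. Pairs
  are used instead of diameters, so boundedness of the images never has to be discussed
  separately.\<close>

definition shrinking :: "'a::metric_space set \<Rightarrow> nat set \<Rightarrow> (nat \<Rightarrow> 'a \<Rightarrow> 'a) \<Rightarrow> bool" where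
  "shrinking X I f \<longleftrightarrow>
     (\<forall>e>0. \<exists>M. \<forall>w\<in>lists I. M \<le> length w \<longrightarrow>
        (\<forall>x\<in>X. \<forall>y\<in>X. dist (word_map f w x) (word_map f w y) < e))"

lemma shrinkingD:
  assumes "shrinking X I f" and "0 < e"
  obtains M where "\<And>w x y. w \<in> lists I \<Longrightarrow> M \<le> length w \<Longrightarrow> x \<in> X \<Longrightarrow> y \<in> X \<Longrightarrow>
    dist (word_map f w x) (word_map f w y) < e"
  using assms unfolding shrinking_def by meson

text \<open>The values stay in [1/2, 1), so the empty word still controls the distance and no weight
  magnifies a distance.\<close>

definition level_weight :: "nat \<Rightarrow> real" where
  "level_weight m = (real m + 1) / (real m + 2)"

lemma level_weight_bounds: "1 / 2 \<le> level_weight m" "level_weight m < 1"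
  by (simp_all add: level_weight_def field_simps)

text \<open>Since (m + 1)(m + 3) = (m + 2)^2 - 1, the ratio of consecutive weights is exactly 1 -
  1/(m + 2)^2. It increases to 1, so a common factor below 1 requires a bound \<open>M\<close> on
  the length.\<close>

lemma level_weight_Suc:
  assumes "m \<le> M"
  shows "level_weight m \<le> (1 - 1 / (real M + 2)\<^sup>2) * level_weight (Suc m)"
proof -
  have eq: "level_weight m = (1 - 1 / (real m + 2)\<^sup>2) * level_weight (Suc m)"
    unfolding level_weight_def by (simp add: divide_simps) (simp add: power2_eq_square algebra_simps)
  have "1 / (real M + 2)\<^sup>2 \<le> 1 / (real m + 2)\<^sup>2"
    using assms by (intro divide_left_mono power_mono) auto
  then have "1 - 1 / (real m + 2)\<^sup>2 \<le> 1 - 1 / (real M + 2)\<^sup>2" by simp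
  then show ?thesis
    using eq level_weight_bounds(1)[of "Suc m"] by (metis mult_right_mono order.trans half_gt_zero_iff
        less_imp_le zero_less_one)
qed

text \<open>Set to 0 off \<open>X\<close>, where the supremum may be that of an unbounded set.\<close>

definition orbit_dist ::
  "'a::metric_space set \<Rightarrow> nat set \<Rightarrow> (nat \<Rightarrow> 'a \<Rightarrow> 'a) \<Rightarrow> 'a \<Rightarrow> 'a \<Rightarrow> real" where
  "orbit_dist X I f x y =
     (if x \<in> X \<and> y \<in> X
      then SUP w\<in>lists I. level_weight (length w) * dist (word_map f w x) (word_map f w y)
      else 0)"

lemma finite_short_words: "finite I \<Longrightarrow> finite {w \<in> lists I. length w < M}"
  by (rule finite_subset[OF _ finite_lists_length_le[of I M]]) auto

context
  fixes X :: "'a::metric_space set" and I :: "nat set" and f :: "nat \<Rightarrow> 'a \<Rightarrow> 'a"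
  assumes finite_I: "finite I"
    and maps: "\<And>i. i \<in> I \<Longrightarrow> f i ` X \<subseteq> X"
    and shrink: "shrinking X I f"
begin

text \<open>All words from some length on bring any two points within distance 1, and only finitely
  many shorter words remain because the alphabet is finite.\<close>

lemma orbit_dist_bdd_above:
  assumes "x \<in> X" "y \<in> X"
  shows "bdd_above ((\<lambda>w. level_weight (length w) * dist (word_map f w x) (word_map f w y)) ` lists I)"
    (is "bdd_above (?g ` _)")
proof -
  obtain M where M: "\<And>w x y. w \<in> lists I \<Longrightarrow> M \<le> length w \<Longrightarrow> x \<in> X \<Longrightarrow> y \<in> X \<Longrightarrow>
      dist (word_map f w x) (word_map f w y) < 1"
    using shrinkingD[OF shrink zero_less_one] by blast
  have "bdd_above (?g ` {w \<in> lists I. length w < M})"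
    using finite_short_words[OF finite_I] by (intro bdd_above_finite finite_imageI)
  moreover have "bdd_above (?g ` {w \<in> lists I. M \<le> length w})"
  proof (rule bdd_aboveI2)
    fix w assume "w \<in> {w \<in> lists I. M \<le> length w}"
    then have "dist (word_map f w x) (word_map f w y) \<le> 1"
      using M assms by (auto intro: less_imp_le)
    then show "?g w \<le> 1"
      using level_weight_bounds[of "length w"] by (simp add: mult_le_one)
  qed
  ultimately have "bdd_above (?g ` ({w \<in> lists I. length w < M} \<union> {w \<in> lists I. M \<le> length w}))"
    by (simp only: image_Un bdd_above_Un)
  then show ?thesis
    by (rule bdd_above_mono) auto
qed

lemma orbit_dist_ge:
  assumes "w \<in> lists I" "x \<in> X" "y \<in> X"
  shows "level_weight (length w) * dist (word_map f w x) (word_map f w y) \<le> orbit_dist X I f x y"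
  using assms orbit_dist_bdd_above by (auto simp: orbit_dist_def intro: cSUP_upper)

lemma orbit_dist_le:
  assumes "x \<in> X" "y \<in> X"
    and "\<And>w. w \<in> lists I \<Longrightarrow> level_weight (length w) * dist (word_map f w x) (word_map f w y) \<le> c"
  shows "orbit_dist X I f x y \<le> c"
  using assms unfolding orbit_dist_def by (auto intro!: cSUP_least)

text \<open>The empty word enters the supremum with weight 1/2. This bound gives definiteness of the
  metric and one half of the comparison of topologies.\<close>

lemma dist_le_orbit_dist:
  assumes "x \<in> X" "y \<in> X"
  shows "dist x y \<le> 2 * orbit_dist X I f x y"
  using orbit_dist_ge[of "[]", OF _ assms] by (simp add: level_weight_def)

text \<open>Each word contributes a pseudometric, and a finite supremum of these inherits symmetry
  and the triangle inequality; the empty word separates points.\<close>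

lemma Metric_space_orbit_dist: "Metric_space X (orbit_dist X I f)"
proof
  fix x y
  show "0 \<le> orbit_dist X I f x y"
  proof (cases "x \<in> X \<and> y \<in> X")
    case True
    then show ?thesis using dist_le_orbit_dist[of x y] zero_le_dist[of x y] by linarith
  qed (auto simp: orbit_dist_def)
  show "orbit_dist X I f x y = orbit_dist X I f y x"
    by (simp add: orbit_dist_def dist_commute conj_commute)
next
  fix x y assume xy: "x \<in> X" "y \<in> X"
  have "orbit_dist X I f x x \<le> 0"
    by (rule orbit_dist_le) (use xy in auto)
  then show "orbit_dist X I f x y = 0 \<longleftrightarrow> x = y"
    using dist_le_orbit_dist[OF xy] dist_le_orbit_dist[OF xy(1) xy(1)] by force
next
  fix x y z assume xyz: "x \<in> X" "y \<in> X" "z \<in> X"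
  show "orbit_dist X I f x z \<le> orbit_dist X I f x y + orbit_dist X I f y z"
  proof (rule orbit_dist_le)
    fix w assume w: "w \<in> lists I"
    let ?d = "\<lambda>x y. dist (word_map f w x) (word_map f w y)"
    have "level_weight (length w) * ?d x z \<le> level_weight (length w) * (?d x y + ?d y z)"
      using level_weight_bounds(1)[of "length w"] by (intro mult_left_mono dist_triangle) auto
    also have "\<dots> \<le> orbit_dist X I f x y + orbit_dist X I f y z"
      using orbit_dist_ge[OF w] xyz by (simp add: distrib_left add_mono)
    finally show "level_weight (length w) * ?d x z \<le> orbit_dist X I f x y + orbit_dist X I f y z" .
  qed (use xyz in auto)
qed

text \<open>The family of all word maps is equicontinuous at \<open>x\<close>: long words make every
  distance small regardless of \<open>y\<close>, and the finitely many short words are each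
  continuous. This is the other half of the comparison of topologies.\<close>

lemma orbit_dist_small:
  assumes cont: "\<And>i. i \<in> I \<Longrightarrow> continuous_on X (f i)" and x: "x \<in> X" and e: "0 < e"
  obtains \<delta> where "0 < \<delta>" "\<And>y. y \<in> X \<Longrightarrow> dist x y < \<delta> \<Longrightarrow> orbit_dist X I f x y < e"
proof -
  obtain M where M: "\<And>w x y. w \<in> lists I \<Longrightarrow> M \<le> length w \<Longrightarrow> x \<in> X \<Longrightarrow> y \<in> X \<Longrightarrow>
      dist (word_map f w x) (word_map f w y) < e / 2"
    using shrinkingD[OF shrink, of "e / 2"] e by auto
  have "\<forall>\<^sub>F y in at x within X. dist (word_map f w y) (word_map f w x) < e / 2" if "w \<in> lists I" for w
    using continuous_on_word_map[where I = I and f = f, OF maps cont that] x e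
    by (auto simp only: continuous_on_def intro!: tendstoD)
  then have "\<forall>\<^sub>F y in at x within X. \<forall>w\<in>{w \<in> lists I. length w < M}.
      dist (word_map f w y) (word_map f w x) < e / 2"
    using finite_short_words[OF finite_I] by (intro eventually_ball_finite) auto
  then obtain \<delta> where \<delta>: "0 < \<delta>" and
    near: "\<And>y w. y \<in> X \<Longrightarrow> y \<noteq> x \<Longrightarrow> dist y x < \<delta> \<Longrightarrow> w \<in> lists I \<Longrightarrow> length w < M \<Longrightarrow>
      dist (word_map f w y) (word_map f w x) < e / 2"
    unfolding eventually_at by auto
  show thesis
  proof (rule that[OF \<delta>])
    fix y assume y: "y \<in> X" "dist x y < \<delta>"
    have "orbit_dist X I f x y \<le> e / 2"
    proof (rule orbit_dist_le[OF x y(1)])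
      fix w assume w: "w \<in> lists I"
      have "dist (word_map f w x) (word_map f w y) \<le> e / 2"
        using near[of y w] M[OF w _ x y(1)] w y e
        by (cases "x = y"; cases "length w < M") (auto simp: dist_commute less_imp_le not_less)
      moreover have "level_weight (length w) * dist (word_map f w x) (word_map f w y)
          \<le> 1 * dist (word_map f w x) (word_map f w y)"
        using level_weight_bounds(2)[of "length w"] by (intro mult_right_mono) auto
      ultimately show "level_weight (length w) * dist (word_map f w x) (word_map f w y) \<le> e / 2"
        by simp
    qed
    then show "orbit_dist X I f x y < e" using e by simp
  qed
qed

lemma mtopology_orbit_dist:
  assumes cont: "\<And>i. i \<in> I \<Longrightarrow> continuous_on X (f i)"
  shows "Metric_space.mtopology X (orbit_dist X I f) = top_of_set X"
proof (rule topology_eq[THEN iffD2], intro allI iffI)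
  interpret D: Metric_space X "orbit_dist X I f"
    by (rule Metric_space_orbit_dist)
  fix U
  {
    assume U: "openin D.mtopology U"
    show "openin (top_of_set X) U"
      unfolding openin_euclidean_subtopology_iff
    proof (intro conjI ballI)
      show "U \<subseteq> X" using U by (simp add: D.openin_mtopology)
      fix x assume x: "x \<in> U"
      obtain e where e: "0 < e" "D.mball x e \<subseteq> U"
        using U x by (auto simp: D.openin_mtopology)
      have xX: "x \<in> X" using x \<open>U \<subseteq> X\<close> by auto
      obtain \<delta> where "0 < \<delta>" "\<And>y. y \<in> X \<Longrightarrow> dist x y < \<delta> \<Longrightarrow> orbit_dist X I f x y < e"
        using orbit_dist_small[OF cont xX e(1)] by blast
      then show "\<exists>\<delta>>0. \<forall>y\<in>X. dist y x < \<delta> \<longrightarrow> y \<in> U"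
        using e xX by (intro exI[of _ \<delta>]) (auto simp: dist_commute subset_iff)
    qed
  next
    assume U: "openin (top_of_set X) U"
    show "openin D.mtopology U"
      unfolding D.openin_mtopology
    proof (intro conjI allI impI)
      show "U \<subseteq> X" using U by (simp add: openin_euclidean_subtopology_iff)
      fix x assume x: "x \<in> U"
      obtain e where e: "0 < e" "\<And>y. y \<in> X \<Longrightarrow> dist y x < e \<Longrightarrow> y \<in> U"
        using U x unfolding openin_euclidean_subtopology_iff by blast
      \<comment> \<open>Half the radius suffices, as \<open>dist\<close> is at most twice
        \<open>orbit_dist\<close>.\<close>
      have "y \<in> U" if "y \<in> D.mball x (e / 2)" for y
        using that dist_le_orbit_dist[of x y] by (intro e(2)) (auto simp: dist_commute)
      then show "\<exists>r>0. D.mball x r \<subseteq> U"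
        using e(1) by (intro exI[of _ "e / 2"]) auto
    qed
  }
qed

text \<open>Let \<open>S\<close> be the distance of the images. If it is positive, long words
  contribute at most \<open>S / 2\<close> to it and cannot realize the supremum. For a short word
  \<open>w\<close>, the term at the images involves the same points as the term of
  \<open>w @ [i]\<close> at \<open>x\<close> and \<open>y\<close>, with a weight smaller by a factor
  of at most \<open>q < 1\<close>. Hence \<open>S\<close> is at most \<open>q\<close> times the
  distance of \<open>x\<close> and \<open>y\<close>.\<close>

lemma Edelstein_contraction_orbit_dist:
  assumes i: "i \<in> I"
  shows "Edelstein_contraction X (orbit_dist X I f) (f i)"
  unfolding Edelstein_contraction_def
proof (intro conjI ballI impI)
  show "f i ` X \<subseteq> X" using maps[OF i] .
  fix x y assume xy: "x \<in> X" "y \<in> X" "x \<noteq> y"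
  have fxy: "f i x \<in> X" "f i y \<in> X" using maps[OF i] xy by auto
  define S where "S = orbit_dist X I f (f i x) (f i y)"
  interpret D: Metric_space X "orbit_dist X I f"
    by (rule Metric_space_orbit_dist)
  have pos: "0 < orbit_dist X I f x y" using D.mdist_pos_less xy by blast
  show "orbit_dist X I f (f i x) (f i y) < orbit_dist X I f x y"
  proof (cases "S = 0")
    case True
    then show ?thesis using pos S_def by simp
  next
    case False
    then have S: "0 < S" using D.nonneg[of "f i x" "f i y"] unfolding S_def by linarith
    obtain M where M: "\<And>w x y. w \<in> lists I \<Longrightarrow> M \<le> length w \<Longrightarrow> x \<in> X \<Longrightarrow> y \<in> X \<Longrightarrow>
        dist (word_map f w x) (word_map f w y) < S / 2"
      using shrinkingD[OF shrink, of "S / 2"] S by auto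
    define q where "q = 1 - 1 / (real M + 2)\<^sup>2"
    have "1 \<le> (real M + 2)\<^sup>2" by (rule one_le_power) simp
    then have q: "0 \<le> q" "q < 1" by (simp_all add: q_def)
    have "S \<le> max (S / 2) (q * orbit_dist X I f x y)"
      unfolding S_def
    proof (rule orbit_dist_le[OF fxy], fold S_def)
      fix w assume w: "w \<in> lists I"
      let ?d = "dist (word_map f w (f i x)) (word_map f w (f i y))"
      show "level_weight (length w) * ?d \<le> max (S / 2) (q * orbit_dist X I f x y)"
      proof (cases "M \<le> length w")
        case True
        have "level_weight (length w) * ?d \<le> 1 * ?d"
          using level_weight_bounds(2)[of "length w"] by (intro mult_right_mono) auto
        then show ?thesis using M[OF w True fxy] by simp
      next
        case False
        then have "level_weight (length w) * ?d \<le> (q * level_weight (Suc (length w))) * ?d"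
          unfolding q_def by (intro mult_right_mono level_weight_Suc) auto
        also have "\<dots> = q * (level_weight (length (w @ [i]))
            * dist (word_map f (w @ [i]) x) (word_map f (w @ [i]) y))"
          by (simp add: word_map_snoc)
        also have "\<dots> \<le> q * orbit_dist X I f x y"
          using w i xy q by (intro mult_left_mono orbit_dist_ge) auto
        finally show ?thesis by simp
      qed
    qed
    then have "S \<le> q * orbit_dist X I f x y" using S by auto
    also have "\<dots> < 1 * orbit_dist X I f x y"
      using q(2) pos by (rule mult_strict_right_mono)
    finally show ?thesis unfolding S_def by simp
  qed
qed

end

section \<open>Shrinking of the cells of a self-similar structure\<close>

text \<open>This is uniform continuity of \<open>\<pi>\<close> expressed through common prefixes.
  Around each infinite word some cylinder has image within \<open>e / 2\<close> of its centre;
  compactness of the shift space leaves finitely many cylinders, and \<open>M\<close> bounds their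
  prefix lengths.\<close>

lemma shift_space_cylinder_small:
  fixes \<pi> :: "(nat \<Rightarrow> nat) \<Rightarrow> 'a::metric_space"
  assumes cont: "continuous_map (shift_space N) (top_of_set K) \<pi>" and e: "0 < e"
  obtains M where "\<And>v w. v \<in> topspace (shift_space N) \<Longrightarrow> w \<in> topspace (shift_space N) \<Longrightarrow>
    (\<And>k. k < M \<Longrightarrow> v k = w k) \<Longrightarrow> dist (\<pi> v) (\<pi> w) < e"
proof -
  let ?S = "topspace (shift_space N)"
  \<comment> \<open>\<open>C v m\<close> is the cylinder of words that agree with \<open>v\<close>
    in the first \<open>m\<close> letters.\<close>
  define C where "C v m = {w \<in> ?S. \<forall>k<m. w k = v k}" for v :: "nat \<Rightarrow> nat" and m :: nat
  have S: "?S = (\<Pi>\<^sub>E i\<in>UNIV. {1..N})"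
    by (simp add: shift_space_def)
  have open_C: "openin (shift_space N) (C v m)" if "v \<in> ?S" for v m
  proof -
    \<comment> \<open>As a product box, the cylinder is a singleton in the first \<open>m\<close>
      coordinates and the full alphabet in all others, hence open.\<close>
    define B where "B i = (if i < m then {v i} else {1..N})" for i
    have "C v m = (\<Pi>\<^sub>E i\<in>UNIV. B i)"
    proof (intro set_eqI iffI)
      fix w assume "w \<in> (\<Pi>\<^sub>E i\<in>UNIV. B i)"
      then have w: "w i \<in> B i" for i by auto
      moreover have "B i \<subseteq> {1..N}" for i using that by (auto simp: B_def S PiE_iff)
      ultimately have "w i \<in> {1..N}" for i by blast
      moreover have "w i = v i" if "i < m" for i using w[of i] that by (simp add: B_def)
      ultimately show "w \<in> C v m" by (auto simp: C_def S)
    qed (auto simp: C_def S B_def PiE_iff)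
    moreover have "finite {i. B i \<noteq> topspace (discrete_topology {1..N})}"
      by (rule finite_subset[of _ "{..<m}"]) (auto simp: B_def split: if_splits)
    moreover have "openin (discrete_topology {1..N}) (B i)" for i
      using that by (auto simp: B_def S PiE_iff)
    ultimately show ?thesis
      unfolding shift_space_def by (auto simp: openin_PiE_gen)
  qed
  have "\<exists>m. \<forall>w\<in>C v m. dist (\<pi> v) (\<pi> w) < e / 2" if v: "v \<in> ?S" for v
  proof -
    let ?U = "{w \<in> ?S. \<pi> w \<in> K \<inter> ball (\<pi> v) (e / 2)}"
    have "\<pi> v \<in> K"
      using cont v by (auto simp: continuous_map_def)
    have "openin (top_of_set K) (K \<inter> ball (\<pi> v) (e / 2))"
      by (rule openin_open_Int) simp
    then have "openin (shift_space N) ?U"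
      by (rule openin_continuous_map_preimage[OF cont])
    moreover have "v \<in> ?U" using v e \<open>\<pi> v \<in> K\<close> by simp
    ultimately obtain B where B: "finite {i. B i \<noteq> {1..N}}" "v \<in> Pi\<^sub>E UNIV B" "Pi\<^sub>E UNIV B \<subseteq> ?U"
      unfolding shift_space_def openin_product_topology_alt by auto
    \<comment> \<open>A basic open box constrains finitely many coordinates; a prefix long enough to
      cover them all gives a cylinder inside the box.\<close>
    obtain m where m: "\<And>i. B i \<noteq> {1..N} \<Longrightarrow> i < m"
      using B(1) finite_nat_set_iff_bounded by auto
    have "C v m \<subseteq> Pi\<^sub>E UNIV B"
    proof
      fix w assume w: "w \<in> C v m"
      have "w i \<in> B i" for i
      proof (cases "i < m")
        case True
        then show ?thesis using w B(2) by (auto simp: C_def PiE_iff)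
      next
        case False
        then have "B i = {1..N}" using m by blast
        then show ?thesis using w by (auto simp: C_def S PiE_iff)
      qed
      then show "w \<in> Pi\<^sub>E UNIV B" by auto
    qed
    then have "\<forall>w\<in>C v m. w \<in> ?U" using B(3) by blast
    then show ?thesis by (intro exI[of _ m]) auto
  qed
  then obtain m where m: "\<And>v w. v \<in> ?S \<Longrightarrow> w \<in> C v (m v) \<Longrightarrow> dist (\<pi> v) (\<pi> w) < e / 2"
    by metis
  have "compact_space (shift_space N)"
    unfolding shift_space_def
    by (simp add: compact_space_product_topology compact_space_discrete_topology)
  moreover have "?S \<subseteq> \<Union> ((\<lambda>v. C v (m v)) ` ?S)"
    by (auto simp: C_def)
  moreover have "\<forall>U\<in>(\<lambda>v. C v (m v)) ` ?S. openin (shift_space N) U"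
    using open_C by auto
  ultimately obtain \<F> where \<F>: "finite \<F>" "\<F> \<subseteq> (\<lambda>v. C v (m v)) ` ?S" "?S \<subseteq> \<Union> \<F>"
    unfolding compact_space_alt by meson
  then obtain A where A: "finite A" "A \<subseteq> ?S" "?S \<subseteq> (\<Union>v\<in>A. C v (m v))"
    using finite_subset_image[OF \<F>(1,2)] by blast
  obtain M where M: "\<And>v. v \<in> A \<Longrightarrow> m v \<le> M"
    using A(1) finite_nat_set_iff_bounded_le[of "m ` A"] by auto
  show thesis
  proof (rule that)
    fix v w assume vw: "v \<in> ?S" "w \<in> ?S" "\<And>k. k < M \<Longrightarrow> v k = w k"
    \<comment> \<open>Since \<open>m a\<close> is at most \<open>M\<close>, the word
      \<open>w\<close> lies in the same cylinder as \<open>v\<close>, and both images are compared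
      with \<open>\<pi> a\<close>.\<close>
    obtain a where a: "a \<in> A" "v \<in> C a (m a)" using A(3) vw(1) by auto
    then have "w \<in> C a (m a)" using vw M[OF a(1)] by (auto simp: C_def)
    then have "dist (\<pi> a) (\<pi> v) < e / 2" "dist (\<pi> a) (\<pi> w) < e / 2"
      using m a A(2) by auto
    then show "dist (\<pi> v) (\<pi> w) < e" by (rule dist_triangle_half_r)
  qed
qed

text \<open>Through \<open>\<pi>\<close>, applying \<open>word_map l w\<close> amounts to prepending
  \<open>w\<close> to an infinite word. Two points of one cell therefore have codes with the common
  prefix \<open>w\<close>, and a long common prefix forces the points together.\<close>

lemma shrinking_self_similar:
  fixes K :: "'a::metric_space set"
  assumes sss: "self_similar_structure K N l \<pi>"
  shows "shrinking K {1..N} l"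
  unfolding shrinking_def
proof (intro allI impI)
  fix e :: real assume e: "0 < e"
  let ?S = "topspace (shift_space N)"
  have cont: "continuous_map (shift_space N) (top_of_set K) \<pi>"
    and onto: "\<pi> ` ?S = K"
    and conj: "\<And>i w. i \<in> {1..N} \<Longrightarrow> w \<in> ?S \<Longrightarrow> l i (\<pi> w) = \<pi> (case_nat i w)"
    using sss by (auto simp: self_similar_structure_def)
  obtain M where M: "\<And>v w. v \<in> ?S \<Longrightarrow> w \<in> ?S \<Longrightarrow> (\<And>k. k < M \<Longrightarrow> v k = w k) \<Longrightarrow>
      dist (\<pi> v) (\<pi> w) < e"
    using shift_space_cylinder_small[OF cont e] by blast
  \<comment> \<open>\<open>foldr case_nat w v\<close> is the infinite word \<open>w\<close> followed
    by \<open>v\<close>.\<close>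
  have prefix: "foldr case_nat w v \<in> ?S \<and> word_map l w (\<pi> v) = \<pi> (foldr case_nat w v) \<and>
      (\<forall>k<length w. foldr case_nat w v k = w ! k)" if "w \<in> lists {1..N}" "v \<in> ?S" for w v
    using that
  proof induction
    case (Cons i w)
    then have "case_nat i (foldr case_nat w v) \<in> ?S"
      by (auto simp: shift_space_def PiE_iff split: nat.split)
    then show ?case
      using Cons conj by (auto simp: nth_Cons split: nat.split)
  qed auto
  show "\<exists>M. \<forall>w\<in>lists {1..N}. M \<le> length w \<longrightarrow>
      (\<forall>x\<in>K. \<forall>y\<in>K. dist (word_map l w x) (word_map l w y) < e)"
  proof (intro exI[of _ M] ballI impI)
    fix w x y assume w: "w \<in> lists {1..N}" "M \<le> length w" and xy: "x \<in> K" "y \<in> K"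
    obtain v v' where v: "v \<in> ?S" "x = \<pi> v" "v' \<in> ?S" "y = \<pi> v'"
      using xy onto by blast
    show "dist (word_map l w x) (word_map l w y) < e"
      using prefix[OF w(1) v(1)] prefix[OF w(1) v(3)] v w(2)
      by (auto intro!: M)
  qed
qed

section \<open>Edelstein contractions of compact sets and skew products\<close>

lemma Edelstein_contraction_nonexpansive:
  assumes "Edelstein_contraction X dist g" "x \<in> X" "y \<in> X"
  shows "dist (g x) (g y) \<le> dist x y"
  using assms unfolding Edelstein_contraction_def by (cases "x = y") (auto intro: less_imp_le)

lemma Edelstein_contraction_continuous_on:
  assumes "Edelstein_contraction X dist g"
  shows "continuous_on X g"
  unfolding continuous_on_iff
  using Edelstein_contraction_nonexpansive[OF assms] by (meson order.strict_trans1)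

text \<open>The loss of distance is a continuous positive function on the compact set of pairs at
  distance at least \<open>e\<close>, so it attains a positive minimum; if there are no such pairs,
  any \<open>\<delta>\<close> will do.\<close>

lemma Edelstein_contraction_gap:
  fixes X :: "'a::metric_space set"
  assumes X: "compact X" and g: "Edelstein_contraction X dist g" and e: "0 < e"
  obtains \<delta> where "0 < \<delta>"
    "\<And>x y. x \<in> X \<Longrightarrow> y \<in> X \<Longrightarrow> e \<le> dist x y \<Longrightarrow> dist (g x) (g y) + \<delta> \<le> dist x y"
proof -
  define A where "A = {z \<in> X \<times> X. e \<le> dist (fst z) (snd z)}"
  define gap where "gap z = dist (fst z) (snd z) - dist (g (fst z)) (g (snd z))" for z
  have "A = (X \<times> X) \<inter> {z. e \<le> dist (fst z) (snd z)}" by (auto simp: A_def)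
  moreover have "closed {z :: 'a \<times> 'a. e \<le> dist (fst z) (snd z)}"
    by (intro closed_Collect_le continuous_intros)
  ultimately have "compact A"
    using X by (simp add: compact_Int_closed compact_Times)
  moreover have "continuous_on A gap"
    unfolding gap_def
    by (intro continuous_intros continuous_on_compose2[OF Edelstein_contraction_continuous_on[OF g]])
      (auto simp: A_def)
  ultimately have gap: "A \<noteq> {} \<Longrightarrow> \<exists>z\<in>A. \<forall>z'\<in>A. gap z \<le> gap z'"
    using continuous_attains_inf by blast
  show thesis
  proof (cases "A = {}")
    case True
    then show ?thesis by (intro that[of 1]) (auto simp: A_def)
  next
    case False
    then obtain z where z: "z \<in> A" "\<And>z'. z' \<in> A \<Longrightarrow> gap z \<le> gap z'" using gap by blast
    show ?thesis
    proof (rule that)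
      show "0 < gap z"
        using z(1) g e unfolding A_def gap_def Edelstein_contraction_def
        by (cases z; cases "fst z = snd z") auto
      fix x y assume "x \<in> X" "y \<in> X" "e \<le> dist x y"
      then show "dist (g x) (g y) + gap z \<le> dist x y"
        using z(2)[of "(x, y)"] by (simp add: A_def gap_def)
    qed
  qed
qed

text \<open>
  In the proof \<open>\<delta>\<close> is the gap of the Edelstein contractions at distance \<open>e\<close>, and the
  oscillation of the fibre shifts is eventually below \<open>\<delta> / 2\<close>. While the vertical distance exceeds
  \<open>e\<close>, each letter decreases it by \<open>\<delta> / 2\<close>; afterwards it stays below \<open>e + \<delta> / 2\<close>.
\<close>

lemma shrinking_skew_product:
  fixes K :: "'a::metric_space set" and J :: "'b::real_normed_vector set"
  assumes I: "finite I" and K: "compact K" and J: "compact J"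
    and l_maps: "\<And>i. i \<in> I \<Longrightarrow> l i ` K \<subseteq> K" and l_shrink: "shrinking K I l"
    and h: "\<And>i. i \<in> I \<Longrightarrow> continuous_on K (h i)"
    and s: "\<And>i. i \<in> I \<Longrightarrow> Edelstein_contraction J dist (s i)"
    and W: "\<And>i x y. i \<in> I \<Longrightarrow> x \<in> K \<Longrightarrow> y \<in> J \<Longrightarrow> W i (x, y) = (l i x, h i x + s i y)"
    and W_maps: "\<And>i. i \<in> I \<Longrightarrow> W i ` (K \<times> J) \<subseteq> K \<times> J"
  shows "shrinking (K \<times> J) I W"
  unfolding shrinking_def
proof (intro allI impI)
  fix e0 :: real assume e0: "0 < e0"
  \<comment> \<open>With \<open>\<delta>\<close> at most \<open>e\<close>, the final vertical bound
    \<open>e + \<delta> / 2\<close> is at most 3/8 of \<open>e0\<close>, leaving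
    \<open>e0 / 2\<close> for the horizontal distance.\<close>
  define e where "e = e0 / 4"
  have e: "0 < e" using e0 by (simp add: e_def)
  have W_in: "word_map W w z \<in> K \<times> J" if "w \<in> lists I" "z \<in> K \<times> J" for w z
    by (rule word_map_in[OF W_maps that])
  have l_in: "word_map l w x \<in> K" if "w \<in> lists I" "x \<in> K" for w x
    by (rule word_map_in[OF l_maps that])
  have fst_W: "fst (word_map W w z) = word_map l w (fst z)"
    if "w \<in> lists I" "z \<in> K \<times> J" for w z
    using that(1)
  proof induction
    case (Cons i w)
    then have "word_map W w z \<in> K \<times> J" using W_in that(2) by blast
    then show ?case using Cons.IH W[OF Cons.hyps(1)] by (cases "word_map W w z") simp
  qed simp
  have "\<exists>\<delta>>0. \<forall>x\<in>J. \<forall>y\<in>J. e \<le> dist x y \<longrightarrow> dist (s i x) (s i y) + \<delta> \<le> dist x y"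
    if "i \<in> I" for i
    using Edelstein_contraction_gap[OF J s[OF that] e] by metis
  then obtain gap where gap: "\<And>i. i \<in> I \<Longrightarrow> 0 < gap i"
    "\<And>i x y. i \<in> I \<Longrightarrow> x \<in> J \<Longrightarrow> y \<in> J \<Longrightarrow> e \<le> dist x y \<Longrightarrow>
      dist (s i x) (s i y) + gap i \<le> dist x y"
    by metis
  \<comment> \<open>Inserting \<open>e\<close> ensures \<open>\<delta> \<le> e\<close> and keeps the
    minimum meaningful for an empty alphabet.\<close>
  define \<delta> where "\<delta> = Min (insert e (gap ` I))"
  have \<delta>: "0 < \<delta>" "\<delta> \<le> e" "\<And>i. i \<in> I \<Longrightarrow> \<delta> \<le> gap i"
    using I e gap(1) by (auto simp: \<delta>_def)
  have osc: "\<exists>M. \<forall>w\<in>lists I. M \<le> length w \<longrightarrow>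
      (\<forall>x\<in>K. \<forall>y\<in>K. dist (h i (word_map l w x)) (h i (word_map l w y)) < \<delta> / 2)"
    if i: "i \<in> I" for i
  proof -
    have "uniformly_continuous_on K (h i)"
      using compact_uniformly_continuous[OF h[OF i] K] .
    then obtain \<eta> where \<eta>: "0 < \<eta>"
      "\<And>x y. x \<in> K \<Longrightarrow> y \<in> K \<Longrightarrow> dist x y < \<eta> \<Longrightarrow> dist (h i x) (h i y) < \<delta> / 2"
      unfolding uniformly_continuous_on_def using \<delta>(1) half_gt_zero by metis
    obtain M where "\<And>w x y. w \<in> lists I \<Longrightarrow> M \<le> length w \<Longrightarrow> x \<in> K \<Longrightarrow> y \<in> K \<Longrightarrow>
        dist (word_map l w x) (word_map l w y) < \<eta>"
      using shrinkingD[OF l_shrink \<eta>(1)] by blast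
    then show ?thesis
      using \<eta>(2) l_in by (intro exI[of _ M]) blast
  qed
  obtain m where m: "\<And>i w x y. i \<in> I \<Longrightarrow> w \<in> lists I \<Longrightarrow> m i \<le> length w \<Longrightarrow> x \<in> K \<Longrightarrow> y \<in> K \<Longrightarrow>
      dist (h i (word_map l w x)) (h i (word_map l w y)) < \<delta> / 2"
    using osc by metis
  \<comment> \<open>The sum serves as a common upper bound of the thresholds
    \<open>m i\<close>.\<close>
  define M where "M = sum m I"
  have M: "dist (h i (word_map l w x)) (h i (word_map l w y)) < \<delta> / 2"
    if "i \<in> I" "w \<in> lists I" "M \<le> length w" "x \<in> K" "y \<in> K" for i w x y
  proof (rule m[OF that(1,2) _ that(4,5)])
    have "m i \<le> M" unfolding M_def using member_le_sum[OF that(1), of m] I by simp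
    then show "m i \<le> length w" using that(3) by (rule order_trans)
  qed
  obtain M' where M': "\<And>w x y. w \<in> lists I \<Longrightarrow> M' \<le> length w \<Longrightarrow> x \<in> K \<Longrightarrow> y \<in> K \<Longrightarrow>
      dist (word_map l w x) (word_map l w y) < e0 / 2"
    using shrinkingD[OF l_shrink, of "e0 / 2"] e0 by auto
  obtain c where c: "\<And>x y. x \<in> J \<Longrightarrow> y \<in> J \<Longrightarrow> dist x y \<le> c"
    using compact_imp_bounded[OF J] bounded_two_points by metis
  \<comment> \<open>The head of a word is its outermost map, so the induction on \<open>k\<close>
    strips the head and the remaining word still has length at least \<open>M\<close>, where the
    oscillation bound applies. At length \<open>M\<close> itself only the bound \<open>c\<close> on
    distances in \<open>J\<close> is available.\<close>
  have decay: "dist (snd (word_map W w z)) (snd (word_map W w z'))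
      \<le> max (e + \<delta> / 2) (c - real k * (\<delta> / 2))"
    if "w \<in> lists I" "length w = M + k" "z \<in> K \<times> J" "z' \<in> K \<times> J" for w z z' k
    using that
  proof (induction k arbitrary: w)
    case 0
    then have "word_map W w z \<in> K \<times> J" "word_map W w z' \<in> K \<times> J"
      using W_in by blast+
    then show ?case using c by (auto simp: max.coboundedI2 mem_Times_iff)
  next
    case (Suc k)
    then obtain i w' where w: "w = i # w'" by (cases w) auto
    have i: "i \<in> I" and w': "w' \<in> lists I" "length w' = M + k"
      using Suc.prems w by auto
    have in_KJ: "word_map W w' z \<in> K \<times> J" "word_map W w' z' \<in> K \<times> J"
      using W_in[OF w'(1)] Suc.prems by blast+
    obtain y y' where y: "word_map W w' z = (word_map l w' (fst z), y)" "y \<in> J"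
      "word_map W w' z' = (word_map l w' (fst z'), y')" "y' \<in> J"
      using in_KJ fst_W[OF w'(1)] Suc.prems(3,4) by (metis mem_Times_iff prod.collapse)
    have "dist (h i (word_map l w' (fst z))) (h i (word_map l w' (fst z'))) < \<delta> / 2"
      using M[OF i w'(1)] w'(2) Suc.prems by auto
    moreover have "word_map l w' (fst z) \<in> K" "word_map l w' (fst z') \<in> K"
      using in_KJ y by auto
    ultimately have step: "dist (snd (word_map W w z)) (snd (word_map W w z'))
        < \<delta> / 2 + dist (s i y) (s i y')"
      using W[OF i] y w dist_triangle_add[of "h i (word_map l w' (fst z))" "s i y"
          "h i (word_map l w' (fst z'))" "s i y'"]
      by simp
    have IH: "dist y y' \<le> max (e + \<delta> / 2) (c - real k * (\<delta> / 2))"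
      using Suc.IH[OF w' Suc.prems(3,4)] y by simp
    show ?case
    proof (cases "e \<le> dist y y'")
      case True
      then have "dist (s i y) (s i y') + \<delta> \<le> dist y y'"
        using gap(2)[OF i y(2,4)] \<delta>(3)[OF i] by force
      then have "dist (snd (word_map W w z)) (snd (word_map W w z')) < dist y y' - \<delta> / 2"
        using step by linarith
      moreover have "c - real (Suc k) * (\<delta> / 2) = c - real k * (\<delta> / 2) - \<delta> / 2"
        by (simp add: algebra_simps add_divide_distrib)
      ultimately show ?thesis using IH \<delta>(1) by (simp only: le_max_iff_disj) linarith
    next
      case False
      then show ?thesis
        using step Edelstein_contraction_nonexpansive[OF s[OF i] y(2,4)] by auto
    qed
  qed
  \<comment> \<open>From this \<open>k\<close> on the linear term is negative, so the maximum in
    \<open>decay\<close> is its first entry.\<close>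
  obtain k where "c / (\<delta> / 2) < real k" using reals_Archimedean2 by blast
  then have k: "c - real k * (\<delta> / 2) < 0" using \<delta>(1) by (simp add: field_simps)
  show "\<exists>M. \<forall>w\<in>lists I. M \<le> length w \<longrightarrow>
      (\<forall>z\<in>K \<times> J. \<forall>z'\<in>K \<times> J. dist (word_map W w z) (word_map W w z') < e0)"
  proof (intro exI[of _ "max M' (M + k)"] ballI impI)
    fix w z z'
    assume w: "w \<in> lists I" "max M' (M + k) \<le> length w" and z: "z \<in> K \<times> J" "z' \<in> K \<times> J"
    let ?z = "word_map W w z" and ?z' = "word_map W w z'"
    obtain k' where k': "length w = M + k'" "k \<le> k'"
      using w(2) by (metis add_le_cancel_left le_add1 le_Suc_ex max.bounded_iff order_trans)
    have "real k * (\<delta> / 2) \<le> real k' * (\<delta> / 2)"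
      using k'(2) \<delta>(1) by (intro mult_right_mono) auto
    then have "dist (snd ?z) (snd ?z') \<le> e + \<delta> / 2"
      using decay[OF w(1) k'(1) z] k e \<delta>(1) by linarith
    moreover have "dist (fst ?z) (fst ?z') < e0 / 2"
      using M'[OF w(1)] w z fst_W by auto
    moreover have "dist ?z ?z' \<le> dist (fst ?z) (fst ?z') + dist (snd ?z) (snd ?z')"
      unfolding dist_prod_def by (rule sqrt_sum_squares_le_sum) auto
    ultimately show "dist ?z ?z' < e0" using \<delta>(2) e0 by (simp add: e_def)
  qed
qed

section \<open>The metric on the product of \<open>K\<close> and \<open>J\<close>\<close>

theorem theorem3p2:
  fixes K V\<^sub>0 :: "(real ^ 'n) set"
    and N L :: nat
    and l :: "nat \<Rightarrow> real ^ 'n \<Rightarrow> real ^ 'n"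
    and \<pi> :: "(nat \<Rightarrow> nat) \<Rightarrow> real ^ 'n"
    and H :: "real ^ 'n \<Rightarrow> real ^ 'n \<Rightarrow> real"
    and r b :: "nat \<Rightarrow> real"
    and p :: "nat \<Rightarrow> real ^ 'n"
    and J :: "real set"
    and u :: "real ^ 'n \<Rightarrow> real"
    and h :: "nat \<Rightarrow> real ^ 'n \<Rightarrow> real"
    and s :: "nat \<Rightarrow> real \<Rightarrow> real"
    and F :: "nat \<Rightarrow> (real ^ 'n) \<times> real \<Rightarrow> real"
    and W :: "nat \<Rightarrow> (real ^ 'n) \<times> real \<Rightarrow> (real ^ 'n) \<times> real"
  assumes pcf: "pcf_structure K N l \<pi>"
    and V0: "V\<^sub>0 = boundary0 K N l \<pi>"
    and regular: "regular_harmonic_structure N l V\<^sub>0 H r"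
    and b: "\<forall>i\<in>{1..N}. 0 < b i \<and> b i < 1"
    and separation_or_chains:
      "(\<exists>k\<^sub>1>0. \<forall>t. 0 < t \<and> t < 1 \<longrightarrow>
          (\<forall>w\<in>word_partition N b t. \<forall>v\<in>word_partition N b t.
             cell K l w \<inter> cell K l v = {} \<longrightarrow> setdist (cell K l w) (cell K l v) \<ge> k\<^sub>1 * t)) \<or>
       (\<exists>k\<^sub>2>0. \<exists>M>0. \<forall>t. 0 < t \<and> t < 1 \<longrightarrow>
          (\<forall>x\<^sub>0\<in>K. \<forall>y\<in>ball x\<^sub>0 (k\<^sub>2 * t) \<inter> K.
             \<exists>n\<^sub>0 x. 1 \<le> n\<^sub>0 \<and> real n\<^sub>0 \<le> M \<and> x 0 = x\<^sub>0 \<and> x n\<^sub>0 = y \<and>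
               (\<forall>k\<le>n\<^sub>0. x k \<in> K) \<and>
               (\<forall>k\<in>{1..n\<^sub>0}. \<exists>w\<in>word_partition N b t.
                  x (k - 1) \<in> cell K l w \<and> x k \<in> cell K l w)))"
    and enum: "bij_betw p {1..L} V\<^sub>0"
    and J: "compact J"
    and u: "u ` vertices N l V\<^sub>0 1 \<subseteq> J"
    and h: "\<forall>n\<in>{1..N}. harmonic_function K N l V\<^sub>0 H r (h n) \<and> \<not> (h n) constant_on K"
    and s: "\<forall>n\<in>{1..N}. Edelstein_contraction J dist (s n)"
    and F: "\<forall>n\<in>{1..N}. \<forall>x\<in>K. \<forall>y\<in>J. F n (x, y) = h n x + s n y"
    and F_maps: "\<forall>n\<in>{1..N}. F n ` (K \<times> J) \<subseteq> J"
    and join_up: "\<forall>n\<in>{1..N}. \<forall>k\<in>{1..L}. h n (p k) + s n (u (p k)) = u (l n (p k))"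
    and W: "\<forall>n\<in>{1..N}. \<forall>x\<in>K. \<forall>y\<in>J. W n (x, y) = (l n x, F n (x, y))"
  shows "\<exists>d\<^sub>\<theta>. Metric_space (K \<times> J) d\<^sub>\<theta> \<and>
           Metric_space.mtopology (K \<times> J) d\<^sub>\<theta> = top_of_set (K \<times> J) \<and>
           (\<forall>n\<in>{1..N}. Edelstein_contraction (K \<times> J) d\<^sub>\<theta> (W n))"
proof -
  have sss: "self_similar_structure K N l \<pi>"
    using pcf by (simp add: pcf_structure_def)
  then have K: "compact K" and l_maps: "\<And>i. i \<in> {1..N} \<Longrightarrow> l i ` K \<subseteq> K"
    and l_cont: "\<And>i. i \<in> {1..N} \<Longrightarrow> continuous_on K (l i)"
    by (auto simp: self_similar_structure_def)
  have h_cont: "continuous_on K (h i)" if "i \<in> {1..N}" for i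
    using h that by (auto simp: harmonic_function_def harmonic_with_boundary_values_def)
  have s': "Edelstein_contraction J dist (s i)" if "i \<in> {1..N}" for i
    using s that by blast
  have W_eq: "W i (x, y) = (l i x, h i x + s i y)" if "i \<in> {1..N}" "x \<in> K" "y \<in> J" for i x y
    using W F that by simp
  have W_maps: "W i ` (K \<times> J) \<subseteq> K \<times> J" if "i \<in> {1..N}" for i
    using W F_maps l_maps that by (fastforce simp: image_subset_iff)
  have W_cont: "continuous_on (K \<times> J) (W i)" if i: "i \<in> {1..N}" for i
  proof -
    \<comment> \<open>The maps \<open>W i\<close> are prescribed only on
      \<open>K \<times> J\<close>; continuity is shown for the explicit formula and transferred by
      agreement there.\<close>
    have "continuous_on (K \<times> J) (\<lambda>z. (l i (fst z), h i (fst z) + s i (snd z)))"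
      by (intro continuous_intros continuous_on_compose2[OF l_cont[OF i]]
          continuous_on_compose2[OF h_cont[OF i]]
          continuous_on_compose2[OF Edelstein_contraction_continuous_on[OF s'[OF i]]]) auto
    then show ?thesis
      by (rule continuous_on_eq) (use W_eq[OF i] in auto)
  qed
  have shrink: "shrinking (K \<times> J) {1..N} W"
    by (rule shrinking_skew_product[OF finite_atLeastAtMost K J l_maps
          shrinking_self_similar[OF sss] h_cont s' W_eq W_maps])
  \<comment> \<open>The witness is \<open>orbit_dist (K \<times> J) {1..N} W\<close>.\<close>
  show ?thesis
    using Metric_space_orbit_dist[OF finite_atLeastAtMost W_maps shrink]
      mtopology_orbit_dist[OF finite_atLeastAtMost W_maps shrink W_cont]
      Edelstein_contraction_orbit_dist[OF finite_atLeastAtMost W_maps shrink]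
    by blast
qed

end
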